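(* Let $\lambda\ge 0$, $\varepsilon>0$ and $\sigma=\sigma(\lambda,\varepsilon)$. Let $\tilde v_\sigma$ be the solution on $[0,\infty)$ of the ordinary differential equation $$\frac{d}{dt}\tilde v_\sigma(t)=\sigma\,\tilde v_\sigma(t)^2-\tilde v_\sigma(t),\qquad \tilde v_\sigma(0)=1 .$$ Then the partition function $v_\sigma(t)=\mathbb{E}\left[\sigma^{n(t)-1}\right]$ satisfies $v_\sigma(t)=\tilde v_\sigma(t)$ for all $t\ge 0$.
   Context: Binary branching Brownian motion (BBM) on $\mathbb{R}$: start with a single particle at $0$ at time $0$. Each particle moves as a standard Brownian motion and lives for an independent standard (rate $1$) exponential time, at the end of which it is replaced by exactly two particles that continue from its position independently according to the same rules. $\mathbb{P}$, $\mathbb{E}$ denote the law and expectation of BBM and $n(t)$ is the number of particles at time $t$. Set $\sigma(\lambda,\varepsilon)=\operatorname{sech}(\varepsilon\sqrt{2\lambda})$. *)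

theory Defs
  imports "HOL-Probability.Probability"
begin

definition standard_brownian_motion :: "'a measure \<Rightarrow> (real \<Rightarrow> 'a \<Rightarrow> real) \<Rightarrow> bool" where
  "standard_brownian_motion M B \<longleftrightarrow>
     prob_space M \<and>
     (\<forall>t\<ge>0. B t \<in> borel_measurable M) \<and>
     (AE \<omega> in M. B 0 \<omega> = 0 \<and> continuous_on {0..} (\<lambda>t. B t \<omega>)) \<and>
     (\<forall>(\<tau> :: nat \<Rightarrow> real) k. 0 \<le> \<tau> 0 \<longrightarrow> incseq \<tau> \<longrightarrow>
        prob_space.indep_vars M (\<lambda>_. borel) (\<lambda>i \<omega>. B (\<tau> (Suc i)) \<omega> - B (\<tau> i) \<omega>) {..<k}) \<and>
     (\<forall>s t. 0 \<le> s \<longrightarrow> s < t \<longrightarrow>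
        distributed M lborel (\<lambda>\<omega>. B t \<omega> - B s \<omega>) (normal_density 0 (sqrt (t - s))))"

text \<open>
  Potential particles are labelled by finite words over \<^typ>\<open>bool\<close>, read from the most recent
  generation back: \<open>[]\<close> is the initial particle, and \<open>True # u\<close>, \<open>False # u\<close> are the two
  children of \<open>u\<close>.
\<close>

type_synonym label = "bool list"

text \<open>
  A realisation of binary branching Brownian motion is built from lifetimes \<open>T u\<close> and
  displacement processes \<open>W u\<close>, where \<open>W u s\<close> is the displacement of \<open>u\<close> from its place of birth
  at age \<open>s\<close>. Independence of all lifetimes and all displacement processes is expressed through
  the sigma-algebras they generate, since they take values in different types.
\<close>

locale binary_bbm = prob_space M
  for M :: "'a measure" +
  fixes T :: "label \<Rightarrow> 'a \<Rightarrow> real"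
    and W :: "label \<Rightarrow> real \<Rightarrow> 'a \<Rightarrow> real"
  assumes lifetime_exponential: "distributed M lborel (T u) (exponential_density 1)"
    and displacement_brownian: "standard_brownian_motion M (W u)"
    and independent:
      "indep_sets
         (case_sum
            (\<lambda>u. sets (vimage_algebra (space M) (T u) borel))
            (\<lambda>u. sets (vimage_algebra (space M) (\<lambda>\<omega>. \<lambda>s\<in>{0..}. W u s \<omega>) (PiM {0..} (\<lambda>_. borel)))))
         UNIV"

primrec birth_time :: "(label \<Rightarrow> 'a \<Rightarrow> real) \<Rightarrow> label \<Rightarrow> 'a \<Rightarrow> real" where
  "birth_time T [] \<omega> = 0"
| "birth_time T (c # u) \<omega> = birth_time T u \<omega> + T u \<omega>"

primrec birth_place ::
    "(label \<Rightarrow> 'a \<Rightarrow> real) \<Rightarrow> (label \<Rightarrow> real \<Rightarrow> 'a \<Rightarrow> real) \<Rightarrow> label \<Rightarrow> 'a \<Rightarrow> real" where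
  "birth_place T W [] \<omega> = 0"
| "birth_place T W (c # u) \<omega> = birth_place T W u \<omega> + W u (T u \<omega>) \<omega>"

definition position ::
    "(label \<Rightarrow> 'a \<Rightarrow> real) \<Rightarrow> (label \<Rightarrow> real \<Rightarrow> 'a \<Rightarrow> real) \<Rightarrow> label \<Rightarrow> real \<Rightarrow> 'a \<Rightarrow> real" where
  "position T W u t \<omega> = birth_place T W u \<omega> + W u (t - birth_time T u \<omega>) \<omega>"

definition alive :: "(label \<Rightarrow> 'a \<Rightarrow> real) \<Rightarrow> real \<Rightarrow> 'a \<Rightarrow> label set" where
  "alive T t \<omega> = {u. birth_time T u \<omega> \<le> t \<and> t < birth_time T u \<omega> + T u \<omega>}"

text \<open>The configuration at time \<open>t\<close>; keeping the labels counts particles with multiplicity.\<close>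

definition bbm ::
    "(label \<Rightarrow> 'a \<Rightarrow> real) \<Rightarrow> (label \<Rightarrow> real \<Rightarrow> 'a \<Rightarrow> real) \<Rightarrow> real \<Rightarrow> 'a \<Rightarrow> (label \<times> real) set" where
  "bbm T W t \<omega> = (\<lambda>u. (u, position T W u t \<omega>)) ` alive T t \<omega>"

definition num_particles ::
    "(label \<Rightarrow> 'a \<Rightarrow> real) \<Rightarrow> (label \<Rightarrow> real \<Rightarrow> 'a \<Rightarrow> real) \<Rightarrow> real \<Rightarrow> 'a \<Rightarrow> nat" where
  "num_particles T W t \<omega> = card (bbm T W t \<omega>)"

text \<open>
  For \<open>t \<ge> 0\<close> the configuration is almost surely finite and nonempty, so neither the convention
  that infinite sets have cardinality 0 nor the truncated subtraction affects the expectation.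
\<close>

definition partition_function ::
    "'a measure \<Rightarrow> (label \<Rightarrow> 'a \<Rightarrow> real) \<Rightarrow> (label \<Rightarrow> real \<Rightarrow> 'a \<Rightarrow> real) \<Rightarrow> real \<Rightarrow> real \<Rightarrow> real" where
  "partition_function M T W \<sigma> t =
     prob_space.expectation M (\<lambda>\<omega>. \<sigma> ^ (num_particles T W t \<omega> - 1))"

definition sech :: "real \<Rightarrow> real" where
  "sech x = 1 / cosh x"

definition sigma_of :: "real \<Rightarrow> real \<Rightarrow> real" where
  "sigma_of lam eps = sech (eps * sqrt (2 * lam))"

end

theory Submission imports Defs begin

text \<open>
  The probabilistic idea is the branching property. The root particle lives for an exponential time
  \<open>s\<close>; if \<open>s > t\<close> it is alone at time \<open>t\<close>, and otherwise its two children start independent copies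
  of the process that run for time \<open>t - s\<close>. Hence \<open>v\<^sub>\<sigma>(t) = E[\<sigma>^(n(t) - 1)]\<close> should satisfy
  \<open>v\<^sub>\<sigma>(t) = e^(-t) + \<sigma> \<integral> e^(-s) v\<^sub>\<sigma>(t - s)^2 ds\<close> with the integral over \<open>[0, t]\<close>,
  and multiplying by \<open>e^t\<close> and substituting \<open>r = t - s\<close> gives the integrated form of the differential
  equation, \<open>w(t) = 1 + \<sigma> \<integral> e^(-r) w(r)^2 dr\<close> over \<open>[0, t]\<close> with \<open>w(t) = e^t v(t)\<close>.

  The recursion is carried out on approximations that are determined by finitely many generations:
  the truncated weight \<open>Z\<^sub>k\<close> is \<open>\<sigma>^n(t)\<close> when no particle of generation \<open>k\<close> has been born by
  time \<open>t\<close>, and \<open>0\<close> otherwise. It obeys the branching recursion pointwise, so induction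
  on \<open>k\<close> together with independence of the lifetimes of the root and of the two subtrees yields
  \<open>E Z\<^sub>k = \<sigma> e^(-t) w\<^sub>k(t)\<close>, where \<open>w\<^sub>k\<close> is the \<open>k\<close>-th Picard iterate of the integral
  equation (lemma \<open>expectation_truncated_weight\<close>). The Picard iterates converge to \<open>e^t v(t)\<close> for
  any solution \<open>v\<close> of the differential equation, by the usual factorial error bound
  (lemma \<open>picard_tendsto\<close>).

  What remains is that \<open>Z\<^sub>k\<close> approximates \<open>\<sigma>^n(t)\<close>, that is, that the process does not explode.
  This too comes out of the recursion. The weight for \<open>\<sigma> = 1\<close> is the indicator that the truncation
  has no effect, so \<open>\<bar>Z\<^sub>k - \<sigma>^n(t)\<bar>\<close> is at most \<open>1\<close> minus that indicator
  (lemma \<open>truncated_weight_approximates\<close>). Since the constant \<open>1\<close> solves the equation for \<open>\<sigma> = 1\<close>,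
  the expectation of this bound tends to \<open>0\<close>, and the limits of both sides agree.
\<close>

section \<open>Truncated weights of the genealogical tree\<close>

text \<open>
  For nonnegative lifetimes \<open>x\<close> and \<open>t \<ge> 0\<close> this is \<open>\<sigma>\<close> to the number of particles at time \<open>t\<close> if every
  line of descent reaches a particle alive at time \<open>t\<close> within the first \<open>k\<close> generations, and \<open>0\<close>
  otherwise. The value \<open>0\<close> at \<open>k = 0\<close> is what makes a line that is cut off annihilate the whole
  product. Labels list the most recent generation first, so the subtree of the child \<open>c\<close>
  of the root is reached by appending \<open>c\<close> at the end.
\<close>

primrec truncated_weight :: "real \<Rightarrow> nat \<Rightarrow> (label \<Rightarrow> real) \<Rightarrow> real \<Rightarrow> real" where
  "truncated_weight \<sigma> 0 x t = 0"
| "truncated_weight \<sigma> (Suc k) x t =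
     (if t < x [] then \<sigma>
      else truncated_weight \<sigma> k (\<lambda>u. x (u @ [True])) (t - x [])
         * truncated_weight \<sigma> k (\<lambda>u. x (u @ [False])) (t - x []))"

lemma truncated_weight_bounds:
  assumes "0 \<le> \<sigma>" "\<sigma> \<le> 1"
  shows "0 \<le> truncated_weight \<sigma> k x t \<and> truncated_weight \<sigma> k x t \<le> 1"
  using assms by (induction k arbitrary: x t) (auto intro: mult_le_one)

lemma truncated_weight_one_cases: "truncated_weight 1 k x t = 0 \<or> truncated_weight 1 k x t = 1"
  by (induction k arbitrary: x t) (simp, metis truncated_weight.simps(2) mult_1 mult_zero_left mult_zero_right)

text \<open>
  Whether some line is cut off depends on the lifetimes alone, so the case \<open>\<sigma> = 1\<close> controls
  the vanishing for every other parameter.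
\<close>

lemma truncated_weight_eq_0:
  "truncated_weight 1 k x t = 0 \<Longrightarrow> truncated_weight \<sigma> k x t = 0"
  by (induction k arbitrary: x t) (auto split: if_splits)

lemma borel_measurable_truncated_weight:
  assumes "\<And>u. (\<lambda>\<omega>. x \<omega> u) \<in> borel_measurable N" and "t \<in> borel_measurable N"
  shows "(\<lambda>\<omega>. truncated_weight \<sigma> k (x \<omega>) (t \<omega>)) \<in> borel_measurable N"
  using assms
proof (induction k arbitrary: x t)
  case 0
  then show ?case by simp
next
  case (Suc k)
  note [measurable] = Suc.prems
  have [measurable]:
    "(\<lambda>\<omega>. truncated_weight \<sigma> k (\<lambda>u. x \<omega> (u @ [c])) (t \<omega> - x \<omega> [])) \<in> borel_measurable N" for c
    by (rule Suc.IH) measurable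
  show ?case by simp
qed

lemma birth_time_append:
  "birth_time T (u @ [c]) \<omega> = T [] \<omega> + birth_time (\<lambda>u. T (u @ [c])) u \<omega>"
  by (induction u) auto

lemma birth_time_nonneg: "(\<And>u. 0 \<le> T u \<omega>) \<Longrightarrow> 0 \<le> birth_time T u \<omega>"
  by (induction u) auto

text \<open>
  The pathwise branching property: the population consists of the root alone before its death
  and is the disjoint union of the populations of the two subtrees from then on.
\<close>

lemma alive_before_first_branching:
  assumes "\<And>u. 0 \<le> T u \<omega>" "0 \<le> t" "t < T [] \<omega>"
  shows "alive T t \<omega> = {[]}"
proof -
  have "u = []" if "birth_time T u \<omega> \<le> t" for u
  proof (cases u rule: rev_cases)
    case (snoc w c)
    have "0 \<le> birth_time (\<lambda>u. T (u @ [c])) w \<omega>"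
      by (rule birth_time_nonneg) (rule assms)
    then show ?thesis using that assms(3) by (simp add: snoc birth_time_append)
  qed
  then show ?thesis using assms by (auto simp: alive_def)
qed

lemma alive_after_first_branching:
  assumes "T [] \<omega> \<le> t"
  shows "alive T t \<omega> = (\<Union>c. (\<lambda>u. u @ [c]) ` alive (\<lambda>u. T (u @ [c])) (t - T [] \<omega>) \<omega>)"
proof (rule set_eqI)
  fix u
  show "u \<in> alive T t \<omega> \<longleftrightarrow>
      u \<in> (\<Union>c. (\<lambda>u. u @ [c]) ` alive (\<lambda>u. T (u @ [c])) (t - T [] \<omega>) \<omega>)"
  proof (cases u rule: rev_cases)
    case Nil
    then show ?thesis using assms by (auto simp: alive_def)
  next
    case (snoc w c)
    then show ?thesis by (auto simp: alive_def birth_time_append image_iff algebra_simps)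
  qed
qed

text \<open>
  The truncation has no effect where the weight for \<open>\<sigma> = 1\<close> does not vanish: every subtree weight in
  the recursion is then nonzero too, and the disjoint union of the subtree populations turns into
  the product of their weights.
\<close>

lemma truncated_weight_eq_power_card:
  assumes "\<And>u. 0 \<le> T u \<omega>" "0 \<le> t" "truncated_weight 1 k (\<lambda>u. T u \<omega>) t \<noteq> 0"
  shows "finite (alive T t \<omega>) \<and> alive T t \<omega> \<noteq> {} \<and>
         truncated_weight \<sigma> k (\<lambda>u. T u \<omega>) t = \<sigma> ^ card (alive T t \<omega>)"
  using assms
proof (induction k arbitrary: T t)
  case 0
  then show ?case by simp
next
  case (Suc k)
  show ?case
  proof (cases "t < T [] \<omega>")
    case True
    then show ?thesis using alive_before_first_branching[of T \<omega> t] Suc.prems by simp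
  next
    case False
    define A where "A c = alive (\<lambda>u. T (u @ [c])) (t - T [] \<omega>) \<omega>" for c
    have IH: "finite (A c)" "A c \<noteq> {}"
      "truncated_weight \<sigma> k (\<lambda>u. T (u @ [c]) \<omega>) (t - T [] \<omega>) = \<sigma> ^ card (A c)" for c
    proof -
      have "truncated_weight 1 k (\<lambda>u. T (u @ [c]) \<omega>) (t - T [] \<omega>) \<noteq> 0"
        using Suc.prems(3) False by (cases c) auto
      then show "finite (A c)" "A c \<noteq> {}"
        "truncated_weight \<sigma> k (\<lambda>u. T (u @ [c]) \<omega>) (t - T [] \<omega>) = \<sigma> ^ card (A c)"
        using Suc.IH[of "\<lambda>u. T (u @ [c])" "t - T [] \<omega>"] Suc.prems False by (auto simp: A_def)
    qed
    have eq: "alive T t \<omega> = (\<lambda>u. u @ [True]) ` A True \<union> (\<lambda>u. u @ [False]) ` A False"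
      using alive_after_first_branching[of T \<omega> t] False by (auto simp: A_def UNIV_bool)
    have "card (alive T t \<omega>) = card (A True) + card (A False)"
      unfolding eq by (subst card_Un_disjoint) (auto simp: IH card_image inj_on_def)
    then show ?thesis using False IH by (auto simp: eq power_add)
  qed
qed

lemma num_particles_eq_card_alive: "num_particles T W t \<omega> = card (alive T t \<omega>)"
  unfolding num_particles_def bbm_def by (intro card_image inj_onI) simp

text \<open>
  The error is at most \<open>1\<close> where a line is cut off and \<open>0\<close> elsewhere. Realisations with
  infinitely many particles are of the first kind for every \<open>k\<close>.
\<close>

lemma truncated_weight_approximates:
  assumes "\<And>u. 0 \<le> T u \<omega>" "0 \<le> t" "0 \<le> \<sigma>" "\<sigma> \<le> 1"
  shows "\<bar>truncated_weight \<sigma> k (\<lambda>u. T u \<omega>) t - \<sigma> * \<sigma> ^ (num_particles T W t \<omega> - 1)\<bar>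
           \<le> 1 - truncated_weight 1 k (\<lambda>u. T u \<omega>) t"
proof (cases "truncated_weight 1 k (\<lambda>u. T u \<omega>) t = 0")
  case True
  moreover have "0 \<le> \<sigma> * \<sigma> ^ n" "\<sigma> * \<sigma> ^ n \<le> 1" for n
    using assms by (auto intro!: mult_le_one power_le_one)
  ultimately show ?thesis by (simp add: truncated_weight_eq_0)
next
  case False
  then have *: "finite (alive T t \<omega>)" "alive T t \<omega> \<noteq> {}"
    "truncated_weight \<sigma> k (\<lambda>u. T u \<omega>) t = \<sigma> ^ card (alive T t \<omega>)"
    using truncated_weight_eq_power_card[of T \<omega> t k \<sigma>] assms by auto
  then have "\<sigma> * \<sigma> ^ (num_particles T W t \<omega> - 1) = \<sigma> ^ card (alive T t \<omega>)"
    unfolding num_particles_eq_card_alive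
    by (metis card_gt_0_iff power_minus_mult mult.commute)
  then show ?thesis
    using * False truncated_weight_one_cases[of k "\<lambda>u. T u \<omega>" t] by auto
qed

text \<open>
  The number of particles is the cardinality of a random subset of a countable set whose
  membership events are measurable; the labels are encoded as natural numbers to say so.
\<close>

lemma measurable_num_particles:
  assumes "\<And>u. T u \<in> borel_measurable M"
  shows "num_particles T W t \<in> measurable M (count_space UNIV)"
proof -
  note [measurable] = assms
  have [measurable]: "birth_time T u \<in> borel_measurable M" for u
    by (induction u) (simp_all add: birth_time.simps[abs_def])
  have "{\<omega> \<in> space M. i \<in> to_nat ` alive T t \<omega>} \<in> sets M" for i
  proof -
    have "{\<omega> \<in> space M. i \<in> to_nat ` alive T t \<omega>} =
        (\<Union>u\<in>{u. to_nat u = i}. {\<omega> \<in> space M. birth_time T u \<omega> \<le> t \<and> t < birth_time T u \<omega> + T u \<omega>})"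
      by (auto simp: alive_def)
    also have "\<dots> \<in> sets M" by (intro sets.countable_UN') auto
    finally show ?thesis .
  qed
  then have "(\<lambda>\<omega>. card (to_nat ` alive T t \<omega>)) \<in> measurable M (count_space UNIV)"
    by (rule measurable_card)
  moreover have "card (to_nat ` alive T t \<omega>) = num_particles T W t \<omega>" for \<omega>
    unfolding num_particles_eq_card_alive by (intro card_image) auto
  ultimately show ?thesis by simp
qed

section \<open>Picard iteration for the logistic equation\<close>

text \<open>
  The iteration for \<open>w' = \<sigma> e^(-t) w^2\<close>, \<open>w(0) = 1\<close>, which is the equation satisfied by
  \<open>w(t) = e^t v(t)\<close>. Passing to \<open>w\<close> removes the linear term, so the right-hand side is monotone on
  nonnegative functions and the iterates started at \<open>0\<close> stay below every solution.
\<close>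

primrec picard :: "real \<Rightarrow> nat \<Rightarrow> real \<Rightarrow> real" where
  "picard \<sigma> 0 t = 0"
| "picard \<sigma> (Suc k) t = 1 + \<sigma> * integral {0..t} (\<lambda>r. exp (- r) * (picard \<sigma> k r)\<^sup>2)"

lemma continuous_on_picard: "continuous_on {0..a} (picard \<sigma> k)"
proof (induction k arbitrary: a)
  case 0
  then show ?case by (simp add: picard.simps[abs_def])
next
  case (Suc k)
  have "(\<lambda>r. exp (- r) * (picard \<sigma> k r)\<^sup>2) integrable_on {0..a}"
    by (intro integrable_continuous_interval continuous_intros Suc)
  then show ?case
    unfolding picard.simps by (intro continuous_intros indefinite_integral_continuous_1)
qed

text \<open>
  On \<open>[0, a]\<close> the nonlinearity has Lipschitz constant \<open>2 C\<close> on values in \<open>[0, C]\<close>, so each iteration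
  integrates the previous error with a factor \<open>2 C\<close>. The bounds \<open>0 \<le> w\<^sub>k \<le> w\<close> are carried along in
  the induction because they keep the iterates in that range.
\<close>

lemma picard_error:
  assumes \<sigma>: "0 \<le> \<sigma>" "\<sigma> \<le> 1"
    and w_eq: "\<And>t. t \<in> {0..a} \<Longrightarrow>
        ((\<lambda>r. exp (- r) * (w r)\<^sup>2) has_integral J t) {0..t} \<and> w t = 1 + \<sigma> * J t"
    and w_le: "\<And>t. t \<in> {0..a} \<Longrightarrow> w t \<le> C"
    and t: "t \<in> {0..a}"
  shows "0 \<le> picard \<sigma> k t \<and> picard \<sigma> k t \<le> w t \<and>
         w t - picard \<sigma> k t \<le> C * (2 * C * t) ^ k / fact k"
  using t
proof (induction k arbitrary: t)
  case 0
  have "0 \<le> J t"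
    using w_eq[OF 0] by (auto intro: has_integral_nonneg)
  then show ?case using \<sigma> w_eq[OF 0] w_le[OF 0] by simp
next
  case (Suc k)
  have sub: "r \<in> {0..a}" if "r \<in> {0..t}" for r using that Suc.prems by auto
  define f where "f = (\<lambda>r. exp (- r) * (picard \<sigma> k r)\<^sup>2)"
  have f: "(f has_integral integral {0..t} f) {0..t}" unfolding f_def
    by (intro integrable_integral integrable_continuous_interval continuous_intros continuous_on_picard)
  have J: "((\<lambda>r. exp (- r) * (w r)\<^sup>2) has_integral J t) {0..t}" and w: "w t = 1 + \<sigma> * J t"
    using w_eq[OF Suc.prems] by auto
  have f_nonneg: "0 \<le> integral {0..t} f"
    using f by (rule has_integral_nonneg) (simp add: f_def)
  have f_le: "integral {0..t} f \<le> J t"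
    using f J
  proof (rule has_integral_le)
    fix r assume "r \<in> {0..t}"
    with Suc.IH[OF sub[OF this]] show "f r \<le> exp (- r) * (w r)\<^sup>2"
      by (auto simp: f_def intro!: power_mono)
  qed
  have diff: "((\<lambda>r. exp (- r) * (w r)\<^sup>2 - f r) has_integral J t - integral {0..t} f) {0..t}"
    by (rule has_integral_diff[OF J f])
  \<comment> \<open>\<open>?b\<close> is \<open>2 C\<close> times the error bound for \<open>k\<close>, and its primitive \<open>?B\<close> is the bound for \<open>k + 1\<close>.\<close>
  let ?b = "\<lambda>r. 2 * C * (C * (2 * C * r) ^ k / fact k)"
  let ?B = "\<lambda>r. C * (2 * C * r) ^ Suc k / fact (Suc k)"
  have "(?b has_integral ?B t - ?B 0) {0..t}"
  proof (rule fundamental_theorem_of_calculus)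
    show "(?B has_vector_derivative ?b r) (at r within {0..t})" for r
      unfolding has_real_derivative_iff_has_vector_derivative[symmetric]
      by (rule derivative_eq_intros refl | simp)+
  qed (use Suc.prems in auto)
  then have "J t - integral {0..t} f \<le> ?B t - ?B 0"
  proof (rule has_integral_le[OF diff])
    fix r assume r: "r \<in> {0..t}"
    note IH = Suc.IH[OF sub[OF r]] and le = w_le[OF sub[OF r]]
    have "exp (- r) * (w r)\<^sup>2 - f r = exp (- r) * ((w r + picard \<sigma> k r) * (w r - picard \<sigma> k r))"
      by (simp add: f_def power2_eq_square algebra_simps)
    also have "\<dots> \<le> 1 * ((w r + picard \<sigma> k r) * (w r - picard \<sigma> k r))"
      using IH r by (intro mult_right_mono) auto
    also have "\<dots> \<le> 2 * C * (C * (2 * C * r) ^ k / fact k)"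
      unfolding mult_1 using IH le by (intro mult_mono) auto
    finally show "exp (- r) * (w r)\<^sup>2 - f r \<le> ?b r" .
  qed
  also have "\<dots> = ?B t" by simp
  finally have J_diff: "J t - integral {0..t} f \<le> ?B t" .
  have p: "picard \<sigma> (Suc k) t = 1 + \<sigma> * integral {0..t} f" by (simp add: f_def)
  have "w t - picard \<sigma> (Suc k) t = \<sigma> * (J t - integral {0..t} f)"
    by (simp only: w p) (simp add: algebra_simps)
  also have "\<dots> \<le> J t - integral {0..t} f"
    using \<sigma> f_le by (intro mult_left_le_one_le) auto
  finally have "w t - picard \<sigma> (Suc k) t \<le> ?B t" using J_diff by linarith
  moreover have "0 \<le> picard \<sigma> (Suc k) t" using f_nonneg \<sigma> unfolding p by simp
  moreover have "picard \<sigma> (Suc k) t \<le> w t"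
    unfolding p w using f_le \<sigma> by (simp add: mult_left_mono)
  ultimately show ?case by blast
qed

lemma picard_tendsto:
  assumes \<sigma>: "0 \<le> \<sigma>" "\<sigma> \<le> 1" and v0: "v 0 = 1"
    and v: "\<And>t. t \<ge> 0 \<Longrightarrow> (v has_real_derivative (\<sigma> * (v t)\<^sup>2 - v t)) (at t within {0..})"
    and a: "0 \<le> a"
  shows "(\<lambda>k. picard \<sigma> k a) \<longlonglongrightarrow> exp a * v a"
proof -
  define w where "w t = exp t * v t" for t
  define J where "J t = integral {0..t} (\<lambda>r. exp (- r) * (w r)\<^sup>2)" for t
  have w': "(w has_real_derivative (\<sigma> * (exp (- t) * (w t)\<^sup>2))) (at t within {0..})" if "t \<ge> 0" for t
  proof -
    have "(w has_real_derivative (exp t * v t + exp t * (\<sigma> * (v t)\<^sup>2 - v t))) (at t within {0..})"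
      unfolding w_def by (rule derivative_eq_intros v that refl | simp)+
    moreover have "exp (- t) * (exp t)\<^sup>2 = exp t"
      by (simp add: power2_eq_square exp_minus)
    then have "exp t * v t + exp t * (\<sigma> * (v t)\<^sup>2 - v t) = \<sigma> * (exp (- t) * (w t)\<^sup>2)"
      by (simp add: w_def power_mult_distrib algebra_simps)
    ultimately show ?thesis by simp
  qed
  have cont: "continuous_on {0..t} w" for t
    unfolding continuous_on_eq_continuous_within
    by (intro ballI continuous_within_subset[OF DERIV_continuous[OF w']]) auto
  have eq: "((\<lambda>r. exp (- r) * (w r)\<^sup>2) has_integral J t) {0..t} \<and> w t = 1 + \<sigma> * J t"
    if "t \<in> {0..a}" for t
  proof
    show J: "((\<lambda>r. exp (- r) * (w r)\<^sup>2) has_integral J t) {0..t}" unfolding J_def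
      by (intro integrable_integral integrable_continuous_interval continuous_intros cont)
    have "((\<lambda>r. \<sigma> * (exp (- r) * (w r)\<^sup>2)) has_integral w t - w 0) {0..t}"
    proof (rule fundamental_theorem_of_calculus)
      fix r assume "r \<in> {0..t}"
      then show "(w has_vector_derivative \<sigma> * (exp (- r) * (w r)\<^sup>2)) (at r within {0..t})"
        unfolding has_real_derivative_iff_has_vector_derivative[symmetric]
        by (intro DERIV_subset[OF w']) auto
    qed (use that in auto)
    from has_integral_unique[OF this has_integral_mult_right[OF J]]
    show "w t = 1 + \<sigma> * J t" by (simp add: w_def v0)
  qed
  have "bounded (w ` {0..a})"
    by (intro compact_imp_bounded compact_continuous_image cont) simp
  then obtain C where C: "\<And>t. t \<in> {0..a} \<Longrightarrow> w t \<le> C"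
    unfolding bounded_iff by (force simp: abs_le_iff)
  have err: "0 \<le> picard \<sigma> k a \<and> picard \<sigma> k a \<le> w a \<and>
         w a - picard \<sigma> k a \<le> C * (2 * C * a) ^ k / fact k" for k
    by (rule picard_error[OF \<sigma> eq C]) (use a in auto)
  have "(\<lambda>k. C * ((2 * C * a) ^ k / fact k)) \<longlonglongrightarrow> C * 0"
    using summable_exp_generic[of "2 * C * a"]
    by (intro tendsto_mult tendsto_const summable_LIMSEQ_zero)
       (simp add: divide_inverse_commute)
  then have "(\<lambda>k. C * (2 * C * a) ^ k / fact k) \<longlonglongrightarrow> 0" by simp
  then have "(\<lambda>k. w a - picard \<sigma> k a) \<longlonglongrightarrow> 0"
    by (rule tendsto_sandwich[OF _ _ tendsto_const, rotated -1]) (use err in auto)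
  from tendsto_diff[OF tendsto_const[of "w a"] this] show ?thesis by (simp add: w_def)
qed

section \<open>Expectation of the truncated weights\<close>

context prob_space
begin

lemma indep_sets_reindex:
  assumes "indep_sets F UNIV" "inj f"
  shows "indep_sets (\<lambda>i. F (f i)) UNIV"
proof (rule indep_setsI)
  fix A J assume J: "J \<noteq> {}" "finite J" and A: "\<forall>j\<in>J. A j \<in> F (f j)"
  have [simp]: "inv f (f j) = j" for j using assms(2) by simp
  have "prob (\<Inter>i\<in>f ` J. A (inv f i)) = (\<Prod>i\<in>f ` J. prob (A (inv f i)))"
    using J A by (intro indep_setsD[OF assms(1)]) auto
  then show "prob (\<Inter>j\<in>J. A j) = (\<Prod>j\<in>J. prob (A j))"
    using assms(2) by (simp add: prod.reindex inj_on_def inj_def image_image)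
qed (use assms(1) in \<open>auto simp: indep_sets_def\<close>)

lemma indep_vars_reindex_inj:
  assumes "indep_vars M' X UNIV" "inj f"
  shows "indep_vars (\<lambda>i. M' (f i)) (\<lambda>i. X (f i)) UNIV"
  using assms indep_sets_reindex[of "\<lambda>i. {X i -` A \<inter> space M | A. A \<in> sets (M' i)}" f]
  unfolding indep_vars_def2 by auto

text \<open>The two subtrees of the root use disjoint sets of labels, hence independent lifetimes.\<close>

lemma expectation_weight_after_first_branching:
  fixes T :: "label \<Rightarrow> 'a \<Rightarrow> real"
  assumes indep: "indep_vars (\<lambda>_. borel) T UNIV" and \<sigma>: "0 \<le> \<sigma>" "\<sigma> \<le> 1"
  shows "expectation (\<lambda>\<omega>. truncated_weight \<sigma> k (\<lambda>u. T (u @ [True]) \<omega>) r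
                        * truncated_weight \<sigma> k (\<lambda>u. T (u @ [False]) \<omega>) r) =
         expectation (\<lambda>\<omega>. truncated_weight \<sigma> k (\<lambda>u. T (u @ [True]) \<omega>) r)
       * expectation (\<lambda>\<omega>. truncated_weight \<sigma> k (\<lambda>u. T (u @ [False]) \<omega>) r)"
proof -
  define D where "D c = range (\<lambda>u::label. u @ [c])" for c
  have [measurable]: "T u \<in> borel_measurable M" for u using indep by (simp add: indep_vars_def2)
  define Y where "Y c = (\<lambda>x. truncated_weight \<sigma> k (\<lambda>u. x (u @ [c])) r)" for c
  have Y: "Y c \<in> borel_measurable (PiM (D c) (\<lambda>_. borel))" for c
    unfolding Y_def by (intro borel_measurable_truncated_weight) (auto simp: D_def)
  have "indep_var (PiM (D True) (\<lambda>_. borel)) (\<lambda>\<omega>. restrict (\<lambda>u. T u \<omega>) (D True))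
                  (PiM (D False) (\<lambda>_. borel)) (\<lambda>\<omega>. restrict (\<lambda>u. T u \<omega>) (D False))"
    by (rule indep_var_restrict[OF indep]) (auto simp: D_def)
  from indep_var_compose[OF this Y Y]
  have "indep_var borel (\<lambda>\<omega>. truncated_weight \<sigma> k (\<lambda>u. T (u @ [True]) \<omega>) r)
                  borel (\<lambda>\<omega>. truncated_weight \<sigma> k (\<lambda>u. T (u @ [False]) \<omega>) r)"
    by (simp add: Y_def D_def o_def)
  moreover have "integrable M (\<lambda>\<omega>. truncated_weight \<sigma> k (\<lambda>u. T (u @ [c]) \<omega>) r)" for c
    using truncated_weight_bounds[OF \<sigma>]
    by (intro integrable_const_bound[where B=1] borel_measurable_truncated_weight AE_I2) auto
  ultimately show ?thesis by (intro indep_var_lebesgue_integral)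
qed

text \<open>
  The lifetime of the root is independent of all the other lifetimes jointly, so by Fubini it can be
  fixed at a value \<open>s\<close> before the expectation over the subtrees is taken.
\<close>

lemma expectation_condition_first_lifetime:
  fixes T :: "label \<Rightarrow> 'a \<Rightarrow> real" and t :: real and k :: nat
  assumes indep: "indep_vars (\<lambda>_. borel) T UNIV" and \<sigma>: "0 \<le> \<sigma>" "\<sigma> \<le> 1"
  defines "G \<equiv> (\<lambda>s. if t < s then \<sigma> else
       expectation (\<lambda>\<omega>. truncated_weight \<sigma> k (\<lambda>u. T (u @ [True]) \<omega>) (t - s)
                      * truncated_weight \<sigma> k (\<lambda>u. T (u @ [False]) \<omega>) (t - s)))"
  shows "expectation (\<lambda>\<omega>. truncated_weight \<sigma> (Suc k) (\<lambda>u. T u \<omega>) t) = expectation (\<lambda>\<omega>. G (T [] \<omega>))"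
    and "G \<in> borel_measurable borel"
proof -
  have [measurable]: "T u \<in> borel_measurable M" for u using indep by (simp add: indep_vars_def2)
  have [measurable]: "(\<lambda>p. truncated_weight \<sigma> k (\<lambda>u. T (u @ [c]) (snd p)) (t - fst p))
      \<in> borel_measurable (borel \<Otimes>\<^sub>M M)" for c
    by (rule borel_measurable_truncated_weight) measurable
  have [measurable]: "(\<lambda>s. expectation (\<lambda>\<omega>. truncated_weight \<sigma> k (\<lambda>u. T (u @ [True]) \<omega>) (t - s)
      * truncated_weight \<sigma> k (\<lambda>u. T (u @ [False]) \<omega>) (t - s))) \<in> borel_measurable borel"
    by (rule borel_measurable_lebesgue_integral) (simp add: split_beta)
  show G[measurable]: "G \<in> borel_measurable borel"
    unfolding G_def by measurable
  (* The root lifetime is kept as a function on the singleton index set, because independent pairs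
     of random variables are formulated for variables with values in a common type. *)
  define Q where "Q = PiM {[]::label} (\<lambda>_. borel :: real measure)"
  define P where "P = PiM (- {[]::label}) (\<lambda>_. borel :: real measure)"
  define S where "S = (\<lambda>\<omega>. restrict (\<lambda>u. T u \<omega>) {[]})"
  define X where "X = (\<lambda>\<omega>. restrict (\<lambda>u. T u \<omega>) (- {[]}))"
  define g where "g = (\<lambda>(z :: label \<Rightarrow> real, x :: label \<Rightarrow> real). if t < z [] then \<sigma> else
      truncated_weight \<sigma> k (\<lambda>u. x (u @ [True])) (t - z [])
    * truncated_weight \<sigma> k (\<lambda>u. x (u @ [False])) (t - z []))"
  have [measurable]: "S \<in> measurable M Q" unfolding S_def Q_def by measurable
  have [measurable]: "X \<in> measurable M P" unfolding X_def P_def by measurable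
  have root[measurable]: "(\<lambda>z. z []) \<in> borel_measurable Q"
    unfolding Q_def by (rule measurable_component_singleton) simp
  have "(\<lambda>x. x (u @ [c])) \<in> borel_measurable P" for u c
    unfolding P_def by (rule measurable_component_singleton) simp
  from measurable_compose[OF measurable_snd this]
  have [measurable]: "(\<lambda>p. truncated_weight \<sigma> k (\<lambda>u. snd p (u @ [c])) (t - fst p []))
      \<in> borel_measurable (Q \<Otimes>\<^sub>M P)" for c
    by (rule borel_measurable_truncated_weight) measurable
  have g[measurable]: "g \<in> borel_measurable (Q \<Otimes>\<^sub>M P)"
    unfolding g_def split_beta by measurable
  have g_bound: "norm (g p) \<le> 1" for p
    using truncated_weight_bounds[OF \<sigma>] \<sigma> by (auto simp: g_def split_beta abs_mult intro!: mult_le_one)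
  have "indep_var Q S P X"
    unfolding P_def X_def Q_def S_def by (rule indep_var_restrict[OF indep]) auto
  then have distr: "distr M Q S \<Otimes>\<^sub>M distr M P X = distr M (Q \<Otimes>\<^sub>M P) (\<lambda>\<omega>. (S \<omega>, X \<omega>))"
    by (simp add: indep_var_distribution_eq)
  interpret S: prob_space "distr M Q S" by (rule prob_space_distr) simp
  interpret X: prob_space "distr M P X" by (rule prob_space_distr) simp
  interpret SX: pair_prob_space "distr M Q S" "distr M P X" ..
  have inner: "(\<integral>x. g (z, x) \<partial>distr M P X) = G (z [])" if "z \<in> space Q" for z
  proof -
    have "(\<integral>x. g (z, x) \<partial>distr M P X) = expectation (\<lambda>\<omega>. g (z, X \<omega>))"
      using that by (intro integral_distr) measurable
    then show ?thesis by (simp add: g_def G_def X_def prob_space cong: if_cong)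
  qed
  have "expectation (\<lambda>\<omega>. truncated_weight \<sigma> (Suc k) (\<lambda>u. T u \<omega>) t) = expectation (\<lambda>\<omega>. g (S \<omega>, X \<omega>))"
    by (simp add: g_def X_def S_def cong: if_cong)
  also have "\<dots> = (\<integral>p. g p \<partial>(distr M Q S \<Otimes>\<^sub>M distr M P X))"
    unfolding distr by (rule integral_distr[symmetric]) measurable
  also have "\<dots> = (\<integral>z. \<integral>x. g (z, x) \<partial>distr M P X \<partial>distr M Q S)"
    by (rule SX.integral_fst'[symmetric], rule SX.integrable_const_bound[where B=1])
       (use g_bound in auto)
  also have "\<dots> = (\<integral>z. G (z []) \<partial>distr M Q S)"
    by (intro Bochner_Integration.integral_cong) (auto simp: inner)
  also have "\<dots> = expectation (\<lambda>\<omega>. G (S \<omega> []))"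
    by (rule integral_distr) measurable
  finally show "expectation (\<lambda>\<omega>. truncated_weight \<sigma> (Suc k) (\<lambda>u. T u \<omega>) t)
      = expectation (\<lambda>\<omega>. G (T [] \<omega>))" by (simp add: S_def)
qed

text \<open>
  The induction is over all families of independent exponential lifetimes at once, since the
  subtree families are again of this kind. Integrating out the first lifetime is exactly one
  Picard step, after the reflection \<open>r = t - s\<close>.
\<close>

lemma expectation_truncated_weight:
  fixes T :: "label \<Rightarrow> 'a \<Rightarrow> real"
  assumes "indep_vars (\<lambda>_. borel) T UNIV"
    and "\<And>u. distributed M lborel (T u) (exponential_density 1)"
    and \<sigma>: "0 \<le> \<sigma>" "\<sigma> \<le> 1" and "0 \<le> t"
  shows "expectation (\<lambda>\<omega>. truncated_weight \<sigma> k (\<lambda>u. T u \<omega>) t) = \<sigma> * exp (- t) * picard \<sigma> k t"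
  using assms(1,2,5)
proof (induction k arbitrary: T t)
  case 0
  then show ?case by simp
next
  case (Suc k)
  note indep = Suc.prems(1) and exp_T = Suc.prems(2) and t = Suc.prems(3)
  have [measurable]: "T u \<in> borel_measurable M" for u using indep by (simp add: indep_vars_def2)
  let ?p = "picard \<sigma> k"
  define F where "F r = (\<sigma> * exp (- r) * ?p r)\<^sup>2" for r
  define G where "G s = (if t < s then \<sigma> else F (t - s))" for s
  have IH: "expectation (\<lambda>\<omega>. truncated_weight \<sigma> k (\<lambda>u. T (u @ [c]) \<omega>) r) = \<sigma> * exp (- r) * ?p r"
    if "0 \<le> r" for r c
  proof (rule Suc.IH)
    show "indep_vars (\<lambda>_. borel) (\<lambda>u. T (u @ [c])) UNIV"
      using indep_vars_reindex_inj[OF indep, of "\<lambda>u. u @ [c]"] by (simp add: inj_def)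
  qed (use exp_T that in auto)
  have G_eq: "(if t < s then \<sigma> else
       expectation (\<lambda>\<omega>. truncated_weight \<sigma> k (\<lambda>u. T (u @ [True]) \<omega>) (t - s)
                      * truncated_weight \<sigma> k (\<lambda>u. T (u @ [False]) \<omega>) (t - s))) = G s" for s
    using expectation_weight_after_first_branching[OF indep \<sigma>] IH[of "t - s"]
    by (simp add: G_def F_def power2_eq_square)
  note cond = expectation_condition_first_lifetime[OF indep \<sigma>, where t = t and k = k, unfolded G_eq]
  note [measurable] = cond(2)
  \<comment> \<open>The Picard iterates inherit their bounds from the weights, being expectations of them.\<close>
  have G_bound: "norm (G s) \<le> 1" for s
  proof -
    have "0 \<le> \<sigma> * exp (- r) * ?p r \<and> \<sigma> * exp (- r) * ?p r \<le> 1" if "0 \<le> r" for r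
    proof -
      have "integrable M (\<lambda>\<omega>. truncated_weight \<sigma> k (\<lambda>u. T (u @ [True]) \<omega>) r)"
        using truncated_weight_bounds[OF \<sigma>]
        by (intro integrable_const_bound[where B=1] borel_measurable_truncated_weight AE_I2) auto
      then show ?thesis unfolding IH[OF that, of True, symmetric]
        using truncated_weight_bounds[OF \<sigma>]
        by (auto intro!: Bochner_Integration.integral_nonneg integral_le_const)
    qed
    from this[of "t - s"] show ?thesis using \<sigma> by (auto simp: G_def F_def abs_square_le_1)
  qed
  have gt: "expectation (\<lambda>\<omega>. indicator {t<..} (T [] \<omega>) * \<sigma>) = \<sigma> * exp (- t)"
  proof -
    have "expectation (\<lambda>\<omega>. indicator {t<..} (T [] \<omega>)) = expectation (indicator {\<omega> \<in> space M. t < T [] \<omega>})"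
      by (intro Bochner_Integration.integral_cong) (auto split: split_indicator)
    also have "\<dots> = exp (- t)"
      using exponential_distributedD_gt[OF exp_T t, of "[]"] by simp
    finally show ?thesis by simp
  qed
  have le: "expectation (\<lambda>\<omega>. indicator {..t} (T [] \<omega>) * G (T [] \<omega>)) =
      \<sigma> * exp (- t) * (\<sigma> * integral {0..t} (\<lambda>r. exp (- r) * (?p r)\<^sup>2))"
  proof -
    have "expectation (\<lambda>\<omega>. indicator {..t} (T [] \<omega>) * G (T [] \<omega>)) =
        (\<integral>s. exponential_density 1 s * (indicator {..t} s * G s) \<partial>lborel)"
      by (rule distributed_integral[OF exp_T, symmetric]) (auto simp: exponential_density_nonneg)
    also have "\<dots> = (\<integral>s. indicator {0..t} s * (exp (- s) * F (t - s)) \<partial>lborel)"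
      by (intro Bochner_Integration.integral_cong)
         (auto simp: exponential_density_def G_def split: split_indicator)
    also have "\<dots> = (\<integral>r. indicator {0..t} r * (exp (- (t - r)) * F r) \<partial>lborel)"
      by (subst lborel_integral_real_affine[where c="-1" and t=t])
         (auto intro!: Bochner_Integration.integral_cong split: split_indicator)
    also have "\<dots> = (\<integral>r. \<sigma>\<^sup>2 * exp (- t) * (indicator {0..t} r * (exp (- r) * (?p r)\<^sup>2)) \<partial>lborel)"
    proof (rule Bochner_Integration.integral_cong[OF refl])
      fix r
      have "exp (- (t - r)) * (exp (- r))\<^sup>2 = exp (- t) * exp (- r)"
        by (simp add: power2_eq_square flip: exp_add)
      then show "indicator {0..t} r * (exp (- (t - r)) * F r) =
          \<sigma>\<^sup>2 * exp (- t) * (indicator {0..t} r * (exp (- r) * (?p r)\<^sup>2))"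
        by (simp add: F_def power_mult_distrib algebra_simps)
    qed
    also have "\<dots> = \<sigma>\<^sup>2 * exp (- t) * (LINT r : {0..t} | lborel. exp (- r) * (?p r)\<^sup>2)"
      by (simp add: set_lebesgue_integral_def)
    also have "(LINT r : {0..t} | lborel. exp (- r) * (?p r)\<^sup>2)
        = integral {0..t} (\<lambda>r. exp (- r) * (?p r)\<^sup>2)"
      by (intro set_borel_integral_eq_integral borel_integrable_atLeastAtMost'
            continuous_intros continuous_on_picard)
    finally show ?thesis by (simp add: power2_eq_square)
  qed
  have "expectation (\<lambda>\<omega>. truncated_weight \<sigma> (Suc k) (\<lambda>u. T u \<omega>) t) =
      expectation (\<lambda>\<omega>. indicator {t<..} (T [] \<omega>) * \<sigma> + indicator {..t} (T [] \<omega>) * G (T [] \<omega>))"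
    unfolding cond(1)
    by (intro Bochner_Integration.integral_cong) (auto simp: G_def split: split_indicator)
  also have "\<dots> = expectation (\<lambda>\<omega>. indicator {t<..} (T [] \<omega>) * \<sigma>)
      + expectation (\<lambda>\<omega>. indicator {..t} (T [] \<omega>) * G (T [] \<omega>))"
  proof (rule Bochner_Integration.integral_add)
    show "integrable M (\<lambda>\<omega>. indicator {t<..} (T [] \<omega>) * \<sigma>)"
      using \<sigma> by (intro integrable_const_bound[where B=1]) (auto split: split_indicator)
    show "integrable M (\<lambda>\<omega>. indicator {..t} (T [] \<omega>) * G (T [] \<omega>))"
      using G_bound by (intro integrable_const_bound[where B=1]) (auto split: split_indicator)
  qed
  finally show ?case by (simp only: gt le picard.simps) (simp add: algebra_simps)
qed

end

section \<open>The partition function\<close>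

lemma (in binary_bbm) indep_lifetimes: "indep_vars (\<lambda>_. borel) T UNIV"
proof -
  have "indep_sets (\<lambda>u. sets (vimage_algebra (space M) (T u) borel)) UNIV"
    using indep_sets_reindex[OF independent, of Inl] by simp
  moreover have "T u \<in> borel_measurable M" for u
    using distributed_measurable[OF lifetime_exponential[of u]] by simp
  ultimately show ?thesis
    by (simp add: indep_vars_def sets_vimage_algebra)
qed

lemma (in binary_bbm) AE_lifetimes_nonneg: "AE \<omega> in M. \<forall>u. 0 \<le> T u \<omega>"
  unfolding AE_all_countable
proof
  fix u
  have [measurable]: "T u \<in> borel_measurable M"
    using distributed_measurable[OF lifetime_exponential[of u]] by simp
  have "prob {\<omega> \<in> space M. 0 < T u \<omega>} = 1"
    using exponential_distributedD_gt[OF lifetime_exponential, of 0 u] by simp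
  then have "AE \<omega> in M. \<omega> \<in> {\<omega> \<in> space M. 0 < T u \<omega>}"
    by (subst AE_in_set_eq_1) auto
  then show "AE \<omega> in M. 0 \<le> T u \<omega>" by eventually_elim auto
qed

text \<open>
  The expectation of the pathwise bound. Its right-hand side is the probability that some
  particle of generation \<open>k\<close> is born by time \<open>t\<close>.
\<close>

lemma (in binary_bbm) partition_function_error:
  assumes \<sigma>: "0 \<le> \<sigma>" "\<sigma> \<le> 1" and t: "0 \<le> t"
  shows "\<bar>\<sigma> * exp (- t) * picard \<sigma> k t - \<sigma> * partition_function M T W \<sigma> t\<bar>
           \<le> 1 - exp (- t) * picard 1 k t"
proof -
  have T[measurable]: "T u \<in> borel_measurable M" for u
    using distributed_measurable[OF lifetime_exponential[of u]] by simp
  have [measurable]: "num_particles T W t \<in> measurable M (count_space UNIV)"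
    by (rule measurable_num_particles) (rule T)
  define Z where "Z = (\<lambda>s \<omega>. truncated_weight s k (\<lambda>u. T u \<omega>) t)"
  define N where "N = (\<lambda>\<omega>. \<sigma> * \<sigma> ^ (num_particles T W t \<omega> - 1))"
  have Z_int: "integrable M (Z s)" if "0 \<le> s" "s \<le> 1" for s
    unfolding Z_def using truncated_weight_bounds[OF that]
    by (intro integrable_const_bound[where B=1] borel_measurable_truncated_weight AE_I2) auto
  have N_int: "integrable M N"
    unfolding N_def using \<sigma>
    by (intro integrable_const_bound[where B=1] AE_I2)
       (auto intro!: mult_le_one power_le_one simp: abs_mult)
  have Z_exp: "expectation (Z s) = s * exp (- t) * picard s k t" if "0 \<le> s" "s \<le> 1" for s
    unfolding Z_def
    by (rule expectation_truncated_weight[OF indep_lifetimes lifetime_exponential that t])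
  have "\<bar>expectation (Z \<sigma>) - expectation N\<bar> = \<bar>expectation (\<lambda>\<omega>. Z \<sigma> \<omega> - N \<omega>)\<bar>"
    using Z_int[OF \<sigma>] N_int by simp
  also have "\<dots> \<le> expectation (\<lambda>\<omega>. \<bar>Z \<sigma> \<omega> - N \<omega>\<bar>)"
    by (rule integral_abs_bound)
  also have "\<dots> \<le> expectation (\<lambda>\<omega>. 1 - Z 1 \<omega>)"
  proof (rule integral_mono_AE)
    show "AE \<omega> in M. \<bar>Z \<sigma> \<omega> - N \<omega>\<bar> \<le> 1 - Z 1 \<omega>"
      using AE_lifetimes_nonneg
      by eventually_elim (unfold Z_def N_def, rule truncated_weight_approximates, use \<sigma> t in auto)
  qed (use Z_int N_int \<sigma> in auto)
  also have "\<dots> = 1 - exp (- t) * picard 1 k t"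
    using Z_int[of 1] Z_exp[of 1] by (simp add: prob_space)
  finally show ?thesis
    by (simp add: Z_exp[OF \<sigma>] N_def partition_function_def)
qed

lemma sigma_of_pos: "0 < sigma_of lam eps"
  by (simp add: sigma_of_def sech_def)

lemma sigma_of_le_1: "sigma_of lam eps \<le> 1"
  by (simp add: sigma_of_def sech_def cosh_real_ge_1)

theorem lemma2p1:
  fixes M :: "'a measure"
    and T :: "label \<Rightarrow> 'a \<Rightarrow> real"
    and W :: "label \<Rightarrow> real \<Rightarrow> 'a \<Rightarrow> real"
    and lam eps \<sigma> :: real
    and v :: "real \<Rightarrow> real"
  assumes "binary_bbm M T W"
    and "lam \<ge> 0" and "eps > 0"
    and "\<sigma> = sigma_of lam eps"
    and "v 0 = 1"
    and "\<And>t. t \<ge> 0 \<Longrightarrow> (v has_real_derivative (\<sigma> * (v t)\<^sup>2 - v t)) (at t within {0..})"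
  shows "\<forall>t\<ge>0. partition_function M T W \<sigma> t = v t"
proof (intro allI impI)
  fix t :: real assume t: "0 \<le> t"
  interpret binary_bbm M T W by fact
  have \<sigma>: "0 < \<sigma>" "\<sigma> \<le> 1" using assms(4) sigma_of_pos sigma_of_le_1 by auto
  have "(\<lambda>k. picard \<sigma> k t) \<longlonglongrightarrow> exp t * v t"
    by (rule picard_tendsto) (use \<sigma> t assms in auto)
  then have lim: "(\<lambda>k. \<sigma> * exp (- t) * picard \<sigma> k t) \<longlonglongrightarrow> \<sigma> * exp (- t) * (exp t * v t)"
    by (intro tendsto_intros)
  \<comment> \<open>Nonexplosion: for parameter \<open>1\<close> the iterates converge to the solution given by the constant \<open>1\<close>.\<close>
  have "(\<lambda>k. picard 1 k t) \<longlonglongrightarrow> exp t * 1"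
    by (rule picard_tendsto[where v = "\<lambda>_. 1"]) (use t in auto)
  then have "(\<lambda>k. 1 - exp (- t) * picard 1 k t) \<longlonglongrightarrow> 1 - exp (- t) * (exp t * 1)"
    by (intro tendsto_intros)
  then have lim1: "(\<lambda>k. 1 - exp (- t) * picard 1 k t) \<longlonglongrightarrow> 0"
    by (simp add: exp_minus)
  have "(\<lambda>k. \<sigma> * exp (- t) * picard \<sigma> k t - \<sigma> * partition_function M T W \<sigma> t) \<longlonglongrightarrow> 0"
    by (rule Lim_null_comparison[OF _ lim1])
       (use partition_function_error \<sigma> t in auto)
  then have "(\<lambda>k. \<sigma> * exp (- t) * picard \<sigma> k t) \<longlonglongrightarrow> \<sigma> * partition_function M T W \<sigma> t"
    by (simp add: LIM_zero_iff)
  from LIMSEQ_unique[OF lim this] show "partition_function M T W \<sigma> t = v t"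
    using \<sigma> by (simp add: exp_minus field_simps)
qed

end
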